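(* Let $G(V,E)$ be an undirected graph satisfying the standing assumptions stated in the context, with node set $V=\{1,\dots,n\}$, arc set $E=\{a_1,\dots,a_m\}$, source $1$ and sink $n$. Let $P$ be the path from $1$ to $n$ output by the Earliest Path Algorithm (defined in the context), identified with its arc-incidence vector in $\{0,1\}^m$. Then $P$ is the earliest simple $1$–$n$ path in the BAT ordering, i.e., there is no simple path $X$ from $1$ to $n$ in $G$ (identified with its arc-incidence vector) with $X \ll P$.
   Context: Standing assumptions: $G(V,E)$ is an undirected graph with no parallel arcs and no self-loops, and all nodes are interconnected (the graph is connected). A set of arcs (in particular a path) is identified with the binary vector $X=(x_1,\dots,x_m)$ where $x_i=X(a_i)=1$ iff $a_i$ is in the set. BAT ordering: for $X,X^*\in\{0,1\}^m$, $X\ll X^*$ if there exists an index $i$ with $X(a_i)=0<X^*(a_i)=1$ and $X(a_j)=X^*(a_j)$ for all $j>i$. Earliest Path Algorithm: assign each arc $a_i$ the weight $W(a_i)=2^{i-1}$; run Dijkstra's algorithm from node $1$ with these weights (initialize $\mathrm{dist}[1]=0$, all other $\mathrm{dist}=\infty$, $\mathrm{prev}=\mathrm{NULL}$; repeatedly extract the unprocessed node $u$ of smallest $\mathrm{dist}$, stopping when $u=n$, and relax each arc $u$–$v$: if $\mathrm{dist}[u]+W<\mathrm{dist}[v]$, set $\mathrm{dist}[v]$ to that value and $\mathrm{prev}[v]=u$); then reconstruct the path by following $\mathrm{prev}$ from $n$ back to $1$. *)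

theory Defs
  imports Main "HOL-Library.Extended_Nat" "HOL-Library.FuncSet"
begin

text \<open>
  A graph is given by its number of nodes \<open>n\<close>, its number of arcs \<open>m\<close> and the
  arcs \<open>a 1, \<dots>, a m\<close>, each an unordered pair of nodes from \<open>{1..n}\<close>.
  Values of \<open>a\<close> outside \<open>{1..m}\<close> are irrelevant.
\<close>

definition adjacent :: "nat \<Rightarrow> (nat \<Rightarrow> nat set) \<Rightarrow> nat \<Rightarrow> nat \<Rightarrow> bool" where
  "adjacent m a u v \<longleftrightarrow> (\<exists>i\<in>{1..m}. a i = {u, v})"

definition walk :: "nat \<Rightarrow> nat \<Rightarrow> (nat \<Rightarrow> nat set) \<Rightarrow> nat \<Rightarrow> nat \<Rightarrow> nat list \<Rightarrow> bool" where
  "walk n m a s t vs \<longleftrightarrow>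
     vs \<noteq> [] \<and> hd vs = s \<and> last vs = t \<and> set vs \<subseteq> {1..n} \<and> successively (adjacent m a) vs"

definition simple_path ::
  "nat \<Rightarrow> nat \<Rightarrow> (nat \<Rightarrow> nat set) \<Rightarrow> nat \<Rightarrow> nat \<Rightarrow> nat list \<Rightarrow> bool" where
  "simple_path n m a s t vs \<longleftrightarrow> walk n m a s t vs \<and> distinct vs"

text \<open>
  \<open>card (a i) = 2\<close> excludes self-loops, injectivity excludes parallel arcs.
\<close>

definition connected_simple_graph :: "nat \<Rightarrow> nat \<Rightarrow> (nat \<Rightarrow> nat set) \<Rightarrow> bool" where
  "connected_simple_graph n m a \<longleftrightarrow>
     n \<ge> 1 \<and>
     (\<forall>i\<in>{1..m}. a i \<subseteq> {1..n} \<and> card (a i) = 2) \<and>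
     inj_on a {1..m} \<and>
     (\<forall>u\<in>{1..n}. \<forall>v\<in>{1..n}. \<exists>vs. walk n m a u v vs)"

text \<open>
  Binary vectors \<open>(x\<^sub>1, \<dots>, x\<^sub>m)\<close> are elements of \<open>{1..m} \<rightarrow>\<^sub>E {0, 1}\<close>.
\<close>

definition arc_vector :: "nat \<Rightarrow> (nat \<Rightarrow> nat set) \<Rightarrow> nat list \<Rightarrow> (nat \<Rightarrow> nat)" where
  "arc_vector m a vs =
     (\<lambda>i\<in>{1..m}. if \<exists>k. Suc k < length vs \<and> a i = {vs ! k, vs ! Suc k} then 1 else 0)"

definition bat_less :: "nat \<Rightarrow> (nat \<Rightarrow> nat) \<Rightarrow> (nat \<Rightarrow> nat) \<Rightarrow> bool" where
  "bat_less m X Y \<longleftrightarrow>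
     (\<exists>i\<in>{1..m}. X i = 0 \<and> Y i = 1 \<and> (\<forall>j\<in>{i<..m}. X j = Y j))"

definition arc_weight :: "nat \<Rightarrow> nat" where
  "arc_weight i = 2 ^ (i - 1)"

record dijkstra_state =
  dist :: "nat \<Rightarrow> enat"
  prev :: "nat \<Rightarrow> nat option"
  unprocessed :: "nat set"

definition dijkstra_init :: "nat \<Rightarrow> dijkstra_state" where
  "dijkstra_init n =
     \<lparr>dist = (\<lambda>_. \<infinity>)(1 := 0), prev = (\<lambda>_. None), unprocessed = {1..n}\<rparr>"

definition nearest_unprocessed :: "dijkstra_state \<Rightarrow> nat \<Rightarrow> bool" where
  "nearest_unprocessed \<sigma> u \<longleftrightarrow>
     u \<in> unprocessed \<sigma> \<and> (\<forall>v\<in>unprocessed \<sigma>. dist \<sigma> u \<le> dist \<sigma> v)"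

definition mark_processed :: "nat \<Rightarrow> dijkstra_state \<Rightarrow> dijkstra_state" where
  "mark_processed u \<sigma> = \<sigma>\<lparr>unprocessed := unprocessed \<sigma> - {u}\<rparr>"

text \<open>
  Only used for arcs \<open>i\<close> incident with \<open>u\<close>, so that \<open>v\<close> is the other end point of \<open>a i\<close>.
\<close>

definition relax :: "(nat \<Rightarrow> nat set) \<Rightarrow> nat \<Rightarrow> nat \<Rightarrow> dijkstra_state \<Rightarrow> dijkstra_state" where
  "relax a u i \<sigma> =
     (let v = the_elem (a i - {u}); d = dist \<sigma> u + enat (arc_weight i)
      in if d < dist \<sigma> v
         then \<sigma>\<lparr>dist := (dist \<sigma>)(v := d), prev := (prev \<sigma>)(v := Some u)\<rparr>
         else \<sigma>)"

text \<open>
  \<open>dijkstra n m a \<sigma> \<tau>\<close>: the main loop, started in \<open>\<sigma>\<close>, can stop in \<open>\<tau>\<close>. It is a relation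
  because neither the choice among several nearest nodes nor the order \<open>js\<close> in which the
  arcs at \<open>u\<close> are relaxed is prescribed.
\<close>

inductive dijkstra ::
  "nat \<Rightarrow> nat \<Rightarrow> (nat \<Rightarrow> nat set) \<Rightarrow> dijkstra_state \<Rightarrow> dijkstra_state \<Rightarrow> bool"
  for n m :: nat and a :: "nat \<Rightarrow> nat set" where
  stop: "nearest_unprocessed \<sigma> n \<Longrightarrow> dijkstra n m a \<sigma> (mark_processed n \<sigma>)"
| step: "nearest_unprocessed \<sigma> u \<Longrightarrow> u \<noteq> n \<Longrightarrow>
         distinct js \<Longrightarrow> set js = {i\<in>{1..m}. u \<in> a i} \<Longrightarrow>
         dijkstra n m a (fold (relax a u) js (mark_processed u \<sigma>)) \<tau> \<Longrightarrow>
         dijkstra n m a \<sigma> \<tau>"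

text \<open>
  \<open>traceback p s v vs\<close>: following the predecessors \<open>p\<close> from \<open>v\<close> leads back to \<open>s\<close>,
  and \<open>vs\<close> lists the nodes visited in order from \<open>s\<close> to \<open>v\<close>.
\<close>

inductive traceback ::
  "(nat \<Rightarrow> nat option) \<Rightarrow> nat \<Rightarrow> nat \<Rightarrow> nat list \<Rightarrow> bool"
  for p :: "nat \<Rightarrow> nat option" and s :: nat where
  source: "traceback p s s [s]"
| predecessor: "v \<noteq> s \<Longrightarrow> p v = Some u \<Longrightarrow> traceback p s u vs \<Longrightarrow> traceback p s v (vs @ [v])"

definition earliest_path_output :: "nat \<Rightarrow> nat \<Rightarrow> (nat \<Rightarrow> nat set) \<Rightarrow> nat list \<Rightarrow> bool" where
  "earliest_path_output n m a P \<longleftrightarrow>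
     (\<exists>\<sigma>. dijkstra n m a (dijkstra_init n) \<sigma> \<and> traceback (prev \<sigma>) 1 n P)"

end

theory Submission
  imports Defs
begin

text \<open>
  Since \<open>2 ^ (i - 1)\<close> exceeds the total weight of the arcs \<open>a 1, \<dots>, a (i - 1)\<close>, an earlier
  vector in the BAT ordering has a smaller total weight, so it suffices that Dijkstra's algorithm
  returns a simple path of minimum weight. When it stops, the traced-back path has weight
  \<open>dist n\<close> and is simple because \<open>dist\<close> strictly increases along it. Minimality follows
  from the potential \<open>min (dist v) (dist n)\<close>: it is \<open>0\<close> at the source, equals \<open>dist n\<close> at
  the sink and increases by at most the arc weight along every arc.
\<close>

section \<open>Arc sets and weights of node lists\<close>

definition arcs_of :: "nat \<Rightarrow> (nat \<Rightarrow> nat set) \<Rightarrow> nat list \<Rightarrow> nat set" where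
  "arcs_of m a vs = {i\<in>{1..m}. \<exists>k. Suc k < length vs \<and> a i = {vs ! k, vs ! Suc k}}"

text \<open>Summing over the set of indices rather than along the list makes this the number whose
  binary digits are the entries of \<open>arc_vector\<close>; an arc traversed twice counts
  once.\<close>

definition path_weight :: "nat \<Rightarrow> (nat \<Rightarrow> nat set) \<Rightarrow> nat list \<Rightarrow> nat" where
  "path_weight m a vs = sum arc_weight (arcs_of m a vs)"

lemma arcs_of_subset: "arcs_of m a vs \<subseteq> {1..m}"
  by (auto simp: arcs_of_def)

lemma finite_arcs_of [simp]: "finite (arcs_of m a vs)"
  by (rule finite_subset[OF arcs_of_subset]) simp

lemma arc_vector_eq_indicator:
  "i \<in> {1..m} \<Longrightarrow> arc_vector m a vs i = (if i \<in> arcs_of m a vs then 1 else 0)"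
  by (auto simp: arc_vector_def arcs_of_def)

lemma path_weight_singleton [simp]: "path_weight m a [v] = 0"
  by (simp add: path_weight_def arcs_of_def)

text \<open>Lists grow at the end because \<open>traceback\<close> appends each node after its
  predecessors; the inductions on paths below do the same.\<close>

lemma arcs_of_snoc:
  assumes "vs \<noteq> []"
  shows "arcs_of m a (vs @ [v]) = arcs_of m a vs \<union> {i\<in>{1..m}. a i = {last vs, v}}"
proof -
  have iff: "(\<exists>k. Suc k < length (vs @ [v]) \<and> a i = {(vs @ [v]) ! k, (vs @ [v]) ! Suc k}) \<longleftrightarrow>
      (\<exists>k. Suc k < length vs \<and> a i = {vs ! k, vs ! Suc k}) \<or> a i = {last vs, v}" for i
  proof -
    \<comment> \<open>The consecutive pairs are those of \<open>vs\<close> and one new pair, at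
      position \<open>length vs - 1\<close>, which is the last position of \<open>vs\<close> as
      \<open>vs\<close> is nonempty.\<close>
    have "(\<exists>k. Suc k < length (vs @ [v]) \<and> a i = {(vs @ [v]) ! k, (vs @ [v]) ! Suc k}) \<longleftrightarrow>
        (\<exists>k. (Suc k < length vs \<or> k = length vs - 1) \<and>
          a i = {(vs @ [v]) ! k, (vs @ [v]) ! Suc k})"
      using assms by (intro ex_cong1) (cases vs; auto)
    also have "\<dots> \<longleftrightarrow> (\<exists>k. Suc k < length vs \<and> a i = {(vs @ [v]) ! k, (vs @ [v]) ! Suc k}) \<or>
        a i = {(vs @ [v]) ! (length vs - 1), (vs @ [v]) ! Suc (length vs - 1)}"
      by blast
    also have "(\<exists>k. Suc k < length vs \<and> a i = {(vs @ [v]) ! k, (vs @ [v]) ! Suc k}) \<longleftrightarrow>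
        (\<exists>k. Suc k < length vs \<and> a i = {vs ! k, vs ! Suc k})"
      by (intro ex_cong1) (auto simp: nth_append)
    also have "{(vs @ [v]) ! (length vs - 1), (vs @ [v]) ! Suc (length vs - 1)} = {last vs, v}"
      using assms by (simp add: nth_append last_conv_nth)
    finally show ?thesis .
  qed
  show ?thesis
    unfolding arcs_of_def iff by blast
qed

text \<open>Injectivity of \<open>a\<close> makes \<open>i\<close> the only new index, and freshness
  of \<open>v\<close> ensures that it has not been counted before.\<close>

lemma path_weight_snoc:
  assumes "inj_on a {1..m}" "vs \<noteq> []" "v \<notin> set vs" "i \<in> {1..m}" "a i = {last vs, v}"
  shows "path_weight m a (vs @ [v]) = path_weight m a vs + arc_weight i"
proof -
  have new: "{j\<in>{1..m}. a j = {last vs, v}} = {i}"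
    using assms(4,5) by (auto intro: inj_onD[OF assms(1)])
  have insert: "arcs_of m a (vs @ [v]) = insert i (arcs_of m a vs)"
    unfolding arcs_of_snoc[OF assms(2)] new by blast
  have "i \<notin> arcs_of m a vs"
  proof
    assume "i \<in> arcs_of m a vs"
    then obtain k where "Suc k < length vs" "{last vs, v} = {vs ! k, vs ! Suc k}"
      using assms(5) by (auto simp: arcs_of_def)
    then have "v \<in> {vs ! k, vs ! Suc k}" "{vs ! k, vs ! Suc k} \<subseteq> set vs"
      by auto
    with assms(3) show False by blast
  qed
  then show ?thesis
    by (simp add: path_weight_def insert)
qed

section \<open>Binary weights and the BAT ordering\<close>

lemma sum_arc_weight_less: "1 \<le> i \<Longrightarrow> sum arc_weight {1..<i} < arc_weight i"
proof (induction i rule: dec_induct)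
  case (step i)
  have "sum arc_weight {1..<Suc i} = sum arc_weight {1..<i} + arc_weight i"
    using step.hyps by simp
  also have "\<dots> < 2 * arc_weight i"
    using step.IH by simp
  also have "\<dots> = arc_weight (Suc i)"
    \<comment> \<open>The case split excludes \<open>i = 0\<close>, where truncated subtraction
      gives \<open>arc_weight 0 = arc_weight 1\<close> and doubling fails.\<close>
    using step.hyps by (cases i) (auto simp: arc_weight_def)
  finally show ?case .
qed (simp add: arc_weight_def)

text \<open>Above the deciding index \<open>i\<close> both arc sets agree and cancel. Below it
  \<open>X\<close> can gain at most the weight of all smaller indices, which is less than what
  \<open>Y\<close> gains from \<open>i\<close> alone.\<close>

lemma bat_less_imp_path_weight_less:
  assumes "bat_less m (arc_vector m a X) (arc_vector m a Y)"
  shows "path_weight m a X < path_weight m a Y"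
proof -
  let ?A = "arcs_of m a X" and ?B = "arcs_of m a Y"
  obtain i where i1: "i \<in> {1..m}" "arc_vector m a X i = 0" "arc_vector m a Y i = 1"
    and eq: "\<forall>j\<in>{i<..m}. arc_vector m a X j = arc_vector m a Y j"
    using assms unfolding bat_less_def by blast
  then have i: "i \<in> {1..m}" "i \<notin> ?A" "i \<in> ?B"
    using arc_vector_eq_indicator[OF i1(1), of a] by (metis zero_neq_one)+
  have "j \<in> ?A \<longleftrightarrow> j \<in> ?B" if "j \<in> {i<..m}" for j
  proof -
    have "j \<in> {1..m}" "arc_vector m a X j = arc_vector m a Y j"
      using eq that i(1) by auto
    then show ?thesis
      using arc_vector_eq_indicator[of j m a] by (metis zero_neq_one)
  qed
  then have above: "?A \<inter> {i<..} = ?B \<inter> {i<..}"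
    using arcs_of_subset by fastforce
  have "?A \<subseteq> {1..<i} \<union> (?A \<inter> {i<..})"
  proof
    fix j assume "j \<in> ?A"
    moreover from this have "j \<in> {1..m}" "j \<noteq> i"
      using arcs_of_subset i(2) by blast+
    ultimately show "j \<in> {1..<i} \<union> (?A \<inter> {i<..})"
      by auto
  qed
  then have "sum arc_weight ?A \<le> sum arc_weight ({1..<i} \<union> (?A \<inter> {i<..}))"
    by (intro sum_mono2) auto
  also have "\<dots> = sum arc_weight {1..<i} + sum arc_weight (?A \<inter> {i<..})"
    by (intro sum.union_disjoint) auto
  also have "\<dots> < arc_weight i + sum arc_weight (?B \<inter> {i<..})"
    using sum_arc_weight_less[of i] i by (simp add: above)
  also have "\<dots> = sum arc_weight (insert i (?B \<inter> {i<..}))"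
    by simp
  also have "\<dots> \<le> sum arc_weight ?B"
    using i by (intro sum_mono2) auto
  finally show ?thesis
    by (simp add: path_weight_def)
qed

section \<open>Invariants of the main loop and of relaxation\<close>

definition processed :: "nat \<Rightarrow> dijkstra_state \<Rightarrow> nat set" where
  "processed n \<sigma> = {1..n} - unprocessed \<sigma>"

text \<open>
  The only relaxations that may still be outstanding are those of the arcs \<open>J\<close> from the node
  \<open>u\<close>; between two rounds of the main loop, \<open>J = {}\<close>.
\<close>

definition relaxed_except ::
  "nat \<Rightarrow> nat \<Rightarrow> (nat \<Rightarrow> nat set) \<Rightarrow> nat \<Rightarrow> nat set \<Rightarrow> dijkstra_state \<Rightarrow> bool" where
  "relaxed_except n m a u J \<sigma> \<longleftrightarrow>
     (\<forall>w\<in>processed n \<sigma>. \<forall>v. \<forall>i\<in>{1..m}. a i = {w, v} \<longrightarrow>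
        w = u \<and> i \<in> J \<or> dist \<sigma> v \<le> dist \<sigma> w + enat (arc_weight i))"

text \<open>The predecessor has to be processed because relaxation never changes the distance of a
  processed node; this keeps the equation stable once it is established.\<close>

definition prev_consistent ::
  "nat \<Rightarrow> nat \<Rightarrow> (nat \<Rightarrow> nat set) \<Rightarrow> dijkstra_state \<Rightarrow> bool" where
  "prev_consistent n m a \<sigma> \<longleftrightarrow>
     dist \<sigma> 1 = 0 \<and>
     (\<forall>v. v \<noteq> 1 \<longrightarrow> dist \<sigma> v < \<infinity> \<longrightarrow>
        (\<exists>u i. prev \<sigma> v = Some u \<and> u \<in> processed n \<sigma> \<and> i \<in> {1..m} \<and> a i = {u, v} \<and>
               dist \<sigma> v = dist \<sigma> u + enat (arc_weight i)))"

text \<open>With no outstanding arcs the node argument of \<open>relaxed_except\<close> is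
  irrelevant; quantifying over it avoids choosing a dummy node.\<close>

definition loop_invariant ::
  "nat \<Rightarrow> nat \<Rightarrow> (nat \<Rightarrow> nat set) \<Rightarrow> dijkstra_state \<Rightarrow> bool" where
  "loop_invariant n m a \<sigma> \<longleftrightarrow>
     unprocessed \<sigma> \<subseteq> {1..n} \<and> n \<in> unprocessed \<sigma> \<and> prev_consistent n m a \<sigma> \<and>
     (\<forall>u. relaxed_except n m a u {} \<sigma>) \<and>
     (\<forall>w\<in>processed n \<sigma>. \<forall>v\<in>unprocessed \<sigma>. dist \<sigma> w \<le> dist \<sigma> v)"

text \<open>Describes the middle of a round, with \<open>u\<close> already marked and the arcs in
  \<open>J\<close> outstanding. The value \<open>dist \<sigma> u\<close> is a threshold between
  processed and unprocessed nodes, from which the last clause of \<open>loop_invariant\<close> is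
  recovered.\<close>

definition relax_invariant ::
  "nat \<Rightarrow> nat \<Rightarrow> (nat \<Rightarrow> nat set) \<Rightarrow> nat \<Rightarrow> nat set \<Rightarrow> nat set \<Rightarrow> dijkstra_state \<Rightarrow> bool" where
  "relax_invariant n m a u J U \<sigma> \<longleftrightarrow>
     unprocessed \<sigma> = U \<and> u \<in> processed n \<sigma> \<and> prev_consistent n m a \<sigma> \<and>
     relaxed_except n m a u J \<sigma> \<and>
     (\<forall>w\<in>processed n \<sigma>. dist \<sigma> w \<le> dist \<sigma> u) \<and> (\<forall>v\<in>U. dist \<sigma> u \<le> dist \<sigma> v)"

text \<open>With \<open>y\<close> the distance of the extracted node and \<open>x\<close> that of a
  processed one, this says that relaxation cannot improve a processed node.\<close>

lemma not_add_enat_less: "x \<le> y \<Longrightarrow> \<not> y + enat k < x"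
  by (meson add_increasing2 leD le_less_trans not_le zero_le order_trans)

text \<open>Only an unprocessed node can be lowered, and to no less than
  \<open>dist \<sigma> u\<close>. Hence all processed distances and the threshold stay as they were,
  and arc \<open>j\<close> is settled.\<close>

lemma relax_invariant_relax:
  assumes graph: "\<forall>i\<in>{1..m}. a i \<subseteq> {1..n} \<and> card (a i) = 2"
    and j: "j \<in> {1..m}" "u \<in> a j"
    and inv: "relax_invariant n m a u (insert j J) U \<sigma>"
  shows "relax_invariant n m a u J U (relax a u j \<sigma>)"
proof -
  obtain v where v: "a j = {u, v}" "v \<noteq> u"
  proof -
    have "card (a j) = 2" using graph j by blast
    then obtain x y where "a j = {x, y}" "x \<noteq> y" by (auto simp: card_2_iff)
    with j(2) that show ?thesis by (auto simp: insert_commute)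
  qed
  have "v \<in> {1..n}" using graph j v by blast
  have other: "the_elem (a j - {u}) = v"
    using v by (metis Diff_insert_absorb singletonD the_elem_eq)
  have unique: "v' = v" if "a j = {u, v'}" for v'
    using that v by (auto simp: doubleton_eq_iff)
  let ?d = "dist \<sigma> u + enat (arc_weight j)"
  show ?thesis
  proof (cases "?d < dist \<sigma> v")
    case False
    then have "relax a u j \<sigma> = \<sigma>"
      by (simp add: relax_def other)
    moreover have "relaxed_except n m a u J \<sigma>"
      using inv False unique unfolding relax_invariant_def relaxed_except_def
      by (metis insertE linorder_not_less)
    ultimately show ?thesis
      using inv by (simp add: relax_invariant_def)
  next
    case True
    let ?\<tau> = "relax a u j \<sigma>"
    have dist: "dist ?\<tau> = (dist \<sigma>)(v := ?d)" and prev: "prev ?\<tau> = (prev \<sigma>)(v := Some u)"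
      and U: "unprocessed ?\<tau> = unprocessed \<sigma>" and pr: "processed n ?\<tau> = processed n \<sigma>"
      using True by (simp_all add: relax_def other processed_def)
    have vU: "v \<notin> processed n \<sigma>"
      using inv True not_add_enat_less by (auto simp: relax_invariant_def)
    have v1: "v \<noteq> 1"
      using inv True by (auto simp: relax_invariant_def prev_consistent_def)
    have "prev_consistent n m a ?\<tau>"
      unfolding prev_consistent_def pr
    proof (intro conjI allI impI)
      show "dist ?\<tau> 1 = 0"
        using inv v1 by (simp add: dist relax_invariant_def prev_consistent_def)
      fix x assume x: "x \<noteq> 1" "dist ?\<tau> x < \<infinity>"
      show "\<exists>w i. prev ?\<tau> x = Some w \<and> w \<in> processed n \<sigma> \<and> i \<in> {1..m} \<and> a i = {w, x} \<and>
              dist ?\<tau> x = dist ?\<tau> w + enat (arc_weight i)"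
      proof (cases "x = v")
        case True
        then have "prev ?\<tau> x = Some u" "a j = {u, x}"
          "dist ?\<tau> x = dist ?\<tau> u + enat (arc_weight j)"
          using v by (simp_all add: dist prev)
        moreover have "u \<in> processed n \<sigma>"
          using inv by (simp add: relax_invariant_def)
        ultimately show ?thesis
          using j(1) by blast
      next
        case False
        then have "dist \<sigma> x < \<infinity>" using x by (simp add: dist)
        then obtain w i where "prev \<sigma> x = Some w" "w \<in> processed n \<sigma>" "i \<in> {1..m}"
          "a i = {w, x}" "dist \<sigma> x = dist \<sigma> w + enat (arc_weight i)"
          using inv x(1) unfolding relax_invariant_def prev_consistent_def by blast
        moreover from this have "prev ?\<tau> x = Some w"
          "dist ?\<tau> x = dist ?\<tau> w + enat (arc_weight i)"
          using False vU by (auto simp: dist prev)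
        ultimately show ?thesis by blast
      qed
    qed
    moreover have "relaxed_except n m a u J ?\<tau>"
      unfolding relaxed_except_def pr
    proof (intro ballI allI impI)
      fix w x i assume w: "w \<in> processed n \<sigma>" and i: "i \<in> {1..m}" "a i = {w, x}"
      \<comment> \<open>As \<open>w\<close> is processed, the right-hand side of its bound is
        unchanged, while the left-hand side can only drop.\<close>
      have "w \<noteq> v" using w vU by blast
      show "w = u \<and> i \<in> J \<or> dist ?\<tau> x \<le> dist ?\<tau> w + enat (arc_weight i)"
      proof (cases "w = u \<and> i = j")
        case True
        then have "x = v" using unique i by blast
        with True v show ?thesis by (simp add: dist)
      next
        case False
        then have "w = u \<and> i \<in> J \<or> dist \<sigma> x \<le> dist \<sigma> w + enat (arc_weight i)"
          using inv w i unfolding relax_invariant_def relaxed_except_def by blast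
        with \<open>w \<noteq> v\<close> True show ?thesis
          by (auto simp: dist)
      qed
    qed
    moreover have "\<forall>w\<in>processed n \<sigma>. dist ?\<tau> w \<le> dist ?\<tau> u"
      using inv vU v by (auto simp: dist relax_invariant_def)
    moreover have "\<forall>x\<in>U. dist ?\<tau> u \<le> dist ?\<tau> x"
      using inv v by (auto simp: dist relax_invariant_def add_increasing2)
    ultimately show ?thesis
      using inv by (simp add: relax_invariant_def U pr)
  qed
qed

lemma relax_invariant_fold:
  assumes graph: "\<forall>i\<in>{1..m}. a i \<subseteq> {1..n} \<and> card (a i) = 2"
    and "set js \<subseteq> {i\<in>{1..m}. u \<in> a i}"
    and "relax_invariant n m a u (set js) U \<sigma>"
  shows "relax_invariant n m a u {} U (fold (relax a u) js \<sigma>)"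
  using assms(2,3)
proof (induction js arbitrary: \<sigma>)
  case (Cons j js)
  then show ?case
    using relax_invariant_relax[OF graph, of j u "set js" U \<sigma>] by simp
qed simp

lemma loop_invariant_init:
  assumes "1 \<le> n"
  shows "loop_invariant n m a (dijkstra_init n)"
  using assms by (auto simp: loop_invariant_def dijkstra_init_def processed_def
      prev_consistent_def relaxed_except_def)

text \<open>Marking \<open>u\<close> makes exactly the arcs at \<open>u\<close> outstanding, and the
  fold settles all of them. As \<open>u\<close> was nearest, its distance can serve as the
  threshold.\<close>

lemma loop_invariant_step:
  assumes graph: "\<forall>i\<in>{1..m}. a i \<subseteq> {1..n} \<and> card (a i) = 2"
    and inv: "loop_invariant n m a \<sigma>" and near: "nearest_unprocessed \<sigma> u" and "u \<noteq> n"
    and js: "set js = {i\<in>{1..m}. u \<in> a i}"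
  defines "\<tau> \<equiv> fold (relax a u) js (mark_processed u \<sigma>)"
  shows "loop_invariant n m a \<tau>" "unprocessed \<tau> = unprocessed \<sigma> - {u}"
proof -
  let ?U = "unprocessed \<sigma> - {u}" and ?\<sigma> = "mark_processed u \<sigma>"
  have u: "u \<in> unprocessed \<sigma>" "u \<in> {1..n}"
    using inv near by (auto simp: nearest_unprocessed_def loop_invariant_def)
  have mark: "dist ?\<sigma> = dist \<sigma>" "prev ?\<sigma> = prev \<sigma>" "unprocessed ?\<sigma> = ?U"
    "processed n ?\<sigma> = insert u (processed n \<sigma>)"
    using u by (auto simp: mark_processed_def processed_def)
  have "prev_consistent n m a ?\<sigma>"
    using inv unfolding loop_invariant_def prev_consistent_def mark by blast
  moreover have "relaxed_except n m a u (set js) ?\<sigma>"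
    using inv unfolding loop_invariant_def relaxed_except_def mark js by blast
  moreover have "\<forall>w\<in>processed n ?\<sigma>. dist ?\<sigma> w \<le> dist ?\<sigma> u"
    using inv u unfolding loop_invariant_def mark by blast
  moreover have "\<forall>v\<in>?U. dist ?\<sigma> u \<le> dist ?\<sigma> v"
    using near unfolding nearest_unprocessed_def mark by blast
  ultimately have "relax_invariant n m a u (set js) ?U ?\<sigma>"
    by (simp add: relax_invariant_def mark)
  then have *: "relax_invariant n m a u {} ?U \<tau>"
    unfolding \<tau>_def using graph js by (intro relax_invariant_fold) auto
  then show "unprocessed \<tau> = ?U"
    by (simp add: relax_invariant_def)
  have "dist \<tau> w \<le> dist \<tau> v" if "w \<in> processed n \<tau>" "v \<in> ?U" for w v
    using * that unfolding relax_invariant_def by (meson order_trans)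
  then show "loop_invariant n m a \<tau>"
    using * inv \<open>u \<noteq> n\<close> unfolding relax_invariant_def loop_invariant_def relaxed_except_def
    by auto
qed

section \<open>Termination and the final state\<close>

text \<open>The invariant keeps \<open>n\<close> unprocessed, so a nearest node always exists and
  the loop cannot get stuck; each round removes a node from a finite set.\<close>

lemma dijkstra_terminates:
  assumes graph: "\<forall>i\<in>{1..m}. a i \<subseteq> {1..n} \<and> card (a i) = 2"
    and "loop_invariant n m a \<sigma>"
  shows "\<exists>\<tau>. dijkstra n m a \<sigma> \<tau>"
  using assms(2)
proof (induction "card (unprocessed \<sigma>)" arbitrary: \<sigma> rule: less_induct)
  case less
  have fin: "finite (unprocessed \<sigma>)" "unprocessed \<sigma> \<noteq> {}"
    using less.prems finite_subset by (auto simp: loop_invariant_def)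
  then obtain u where near: "nearest_unprocessed \<sigma> u"
    unfolding nearest_unprocessed_def
    by (metis arg_min_if_finite(1) arg_min_least)
  show ?case
  proof (cases "u = n")
    case True
    with near show ?thesis by (blast intro: dijkstra.stop)
  next
    case False
    obtain js where js: "set js = {i\<in>{1..m}. u \<in> a i}" "distinct js"
      using finite_distinct_list[of "{i\<in>{1..m}. u \<in> a i}"] by auto
    let ?\<tau> = "fold (relax a u) js (mark_processed u \<sigma>)"
    note step = loop_invariant_step[OF graph less.prems near False js(1)]
    have "card (unprocessed ?\<tau>) < card (unprocessed \<sigma>)"
      using near fin(1) unfolding step(2) nearest_unprocessed_def by (blast intro: card_Diff1_less)
    then obtain \<tau> where "dijkstra n m a ?\<tau> \<tau>"
      using less.hyps step(1) by blast
    then show ?thesis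
      using dijkstra.step[OF near False js(2,1)] by blast
  qed
qed

text \<open>Exposes the state just before the sink is marked. There every processed node has been
  relaxed, whereas the arcs at \<open>n\<close> never are.\<close>

lemma dijkstra_final_state:
  assumes graph: "\<forall>i\<in>{1..m}. a i \<subseteq> {1..n} \<and> card (a i) = 2"
    and "dijkstra n m a \<sigma> \<tau>" "loop_invariant n m a \<sigma>"
  obtains \<rho> where "loop_invariant n m a \<rho>" "nearest_unprocessed \<rho> n" "\<tau> = mark_processed n \<rho>"
  using assms(2,3)
proof (induction arbitrary: thesis rule: dijkstra.induct)
  case (stop \<sigma>)
  then show ?case by blast
next
  case (step \<sigma> u js \<tau>)
  then show ?case
    using loop_invariant_step(1)[OF graph step.prems(2) step.hyps(1,2,4)] by blast
qed

section \<open>The cut-off distance as a potential\<close>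

text \<open>Arcs leaving the unprocessed nodes need not be relaxed, hence the cut-off at \<open>dist n\<close>.\<close>

lemma cut_off_dist_le_along_arc:
  assumes "loop_invariant n m a \<sigma>" "nearest_unprocessed \<sigma> n"
    and "i \<in> {1..m}" "a i = {u, v}" "u \<in> {1..n}"
  shows "min (dist \<sigma> v) (dist \<sigma> n) \<le> min (dist \<sigma> u) (dist \<sigma> n) + enat (arc_weight i)"
proof (cases "u \<in> unprocessed \<sigma>")
  case True
  \<comment> \<open>No unprocessed node is nearer than the sink, so the potential of
    \<open>u\<close> is already maximal.\<close>
  then have "min (dist \<sigma> u) (dist \<sigma> n) = dist \<sigma> n"
    using assms(2) by (simp add: nearest_unprocessed_def min_absorb2)
  then show ?thesis
    by (simp add: add_increasing2 min.coboundedI2)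
next
  case False
  then have "u \<in> processed n \<sigma>"
    using assms(5) by (simp add: processed_def)
  then have "dist \<sigma> v \<le> dist \<sigma> u + enat (arc_weight i)" "dist \<sigma> u \<le> dist \<sigma> n"
    using assms unfolding loop_invariant_def relaxed_except_def by blast+
  then show ?thesis
    by (simp add: min_absorb1 min.coboundedI1)
qed

text \<open>The potential starts at \<open>0\<close> and each arc adds a finite amount. For
  \<open>v = n\<close> this shows that a walk to the sink forces \<open>dist \<sigma> n\<close> to
  be finite.\<close>

lemma cut_off_dist_finite:
  assumes inv: "loop_invariant n m a \<sigma>" and near: "nearest_unprocessed \<sigma> n"
    and "walk n m a 1 v vs"
  shows "min (dist \<sigma> v) (dist \<sigma> n) < \<infinity>"
  using assms(3)
proof (induction vs arbitrary: v rule: rev_induct)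
  case (snoc x vs)
  have [simp]: "x = v" using snoc.prems by (simp add: walk_def)
  show ?case
  proof (cases "vs = []")
    case True
    then have "v = 1" using snoc.prems by (simp add: walk_def)
    then show ?thesis
      using inv by (simp add: loop_invariant_def prev_consistent_def min_absorb1)
  next
    case False
    then have "walk n m a 1 (last vs) vs" "adjacent m a (last vs) v" "set vs \<subseteq> {1..n}"
      using snoc.prems by (auto simp: walk_def successively_append_iff)
    moreover from this have "last vs \<in> {1..n}"
      using False last_in_set by blast
    ultimately obtain i where "i \<in> {1..m}" "a i = {last vs, v}"
      and fin: "min (dist \<sigma> (last vs)) (dist \<sigma> n) < \<infinity>"
      using snoc.IH by (auto simp: adjacent_def)
    then have "min (dist \<sigma> v) (dist \<sigma> n)
        \<le> min (dist \<sigma> (last vs)) (dist \<sigma> n) + enat (arc_weight i)"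
      using cut_off_dist_le_along_arc[OF inv near] \<open>last vs \<in> {1..n}\<close> by blast
    also have "\<dots> < \<infinity>"
      using fin by (cases "min (dist \<sigma> (last vs)) (dist \<sigma> n)") auto
    finally show ?thesis .
  qed
qed (simp add: walk_def)

text \<open>Adds up the arc inequality along the path; since the nodes are distinct, each arc
  contributes its weight exactly once. For \<open>v = n\<close> the left-hand side is
  \<open>dist \<sigma> n\<close>.\<close>

lemma cut_off_dist_le_path_weight:
  assumes inj: "inj_on a {1..m}"
    and inv: "loop_invariant n m a \<sigma>" and near: "nearest_unprocessed \<sigma> n"
    and "simple_path n m a 1 v vs"
  shows "min (dist \<sigma> v) (dist \<sigma> n) \<le> enat (path_weight m a vs)"
  using assms(4)
proof (induction vs arbitrary: v rule: rev_induct)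
  case (snoc x vs)
  have [simp]: "x = v" using snoc.prems by (simp add: simple_path_def walk_def)
  show ?case
  proof (cases "vs = []")
    case True
    then have "v = 1" using snoc.prems by (simp add: simple_path_def walk_def)
    then show ?thesis
      using inv by (simp add: loop_invariant_def prev_consistent_def min_absorb1)
  next
    case False
    then have "simple_path n m a 1 (last vs) vs" "adjacent m a (last vs) v" "set vs \<subseteq> {1..n}"
      using snoc.prems by (auto simp: simple_path_def walk_def successively_append_iff)
    moreover from this have last: "last vs \<in> {1..n}"
      using False last_in_set by blast
    ultimately obtain i where i: "i \<in> {1..m}" "a i = {last vs, v}"
      and IH: "min (dist \<sigma> (last vs)) (dist \<sigma> n) \<le> enat (path_weight m a vs)"
      using snoc.IH by (auto simp: adjacent_def)
    have "v \<notin> set vs" using snoc.prems by (simp add: simple_path_def)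
    then have weight: "path_weight m a (vs @ [v]) = path_weight m a vs + arc_weight i"
      using path_weight_snoc[OF inj False _ i] by blast
    have "min (dist \<sigma> v) (dist \<sigma> n)
        \<le> min (dist \<sigma> (last vs)) (dist \<sigma> n) + enat (arc_weight i)"
      using cut_off_dist_le_along_arc[OF inv near i last] .
    also have "\<dots> \<le> enat (path_weight m a vs) + enat (arc_weight i)"
      using IH by (rule add_right_mono)
    finally show ?thesis
      by (simp add: weight)
  qed
qed (simp add: simple_path_def walk_def)

section \<open>Tracing back the predecessors\<close>

text \<open>Weights are positive, so a predecessor at finite distance is strictly nearer. Both the
  existence and the simplicity of the traced-back path rest on this.\<close>

lemma dist_less_add_arc_weight: "x < \<infinity> \<Longrightarrow> x < x + enat (arc_weight i)"
  by (cases x) (auto simp: arc_weight_def)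

text \<open>Finiteness passes to the predecessor, whose distance is strictly smaller, so
  well-founded induction on \<open>enat\<close> applies; only the source has no predecessor to
  follow.\<close>

lemma traceback_exists:
  assumes cons: "prev_consistent n m a \<sigma>" and "dist \<sigma> v < \<infinity>"
  shows "\<exists>vs. traceback (prev \<sigma>) 1 v vs"
  using assms(2)
proof (induction "dist \<sigma> v" arbitrary: v rule: less_induct)
  case less
  show ?case
  proof (cases "v = 1")
    case True
    then show ?thesis by (blast intro: traceback.source)
  next
    case False
    then obtain u i where u: "prev \<sigma> v = Some u"
      and eq: "dist \<sigma> v = dist \<sigma> u + enat (arc_weight i)"
      using cons less.prems unfolding prev_consistent_def by blast
    then have "dist \<sigma> u < \<infinity>"
      using less.prems by (cases "dist \<sigma> u") auto
    then obtain vs where "traceback (prev \<sigma>) 1 u vs"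
      using less.hyps eq dist_less_add_arc_weight by metis
    with False u show ?thesis by (blast intro: traceback.predecessor)
  qed
qed

text \<open>The bound on \<open>dist\<close> along the path is what makes the path simple.\<close>

lemma traceback_simple_path:
  assumes inj: "inj_on a {1..m}" and cons: "prev_consistent n m a \<sigma>"
    and "traceback (prev \<sigma>) 1 v vs" "v \<in> {1..n}" "dist \<sigma> v < \<infinity>"
  shows "simple_path n m a 1 v vs \<and> (\<forall>w\<in>set vs. dist \<sigma> w \<le> dist \<sigma> v) \<and>
         enat (path_weight m a vs) = dist \<sigma> v"
  using assms(3-)
proof (induction rule: traceback.induct)
  case source
  then show ?case
    using cons by (simp add: simple_path_def walk_def prev_consistent_def zero_enat_def)
next
  case (predecessor v u vs)
  obtain i where u: "u \<in> processed n \<sigma>" and i: "i \<in> {1..m}" "a i = {u, v}"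
    and eq: "dist \<sigma> v = dist \<sigma> u + enat (arc_weight i)"
    using cons predecessor.hyps(1,2) predecessor.prems(2) unfolding prev_consistent_def
    by (metis option.inject)
  have fin: "dist \<sigma> u < \<infinity>"
    using predecessor.prems(2) eq by (cases "dist \<sigma> u") auto
  moreover have "u \<in> {1..n}"
    using u by (simp add: processed_def)
  ultimately have path: "simple_path n m a 1 u vs"
    and le: "\<forall>w\<in>set vs. dist \<sigma> w \<le> dist \<sigma> u"
    and weight: "enat (path_weight m a vs) = dist \<sigma> u"
    using predecessor.IH by blast+
  have less: "dist \<sigma> u < dist \<sigma> v"
    unfolding eq using fin by (rule dist_less_add_arc_weight)
  then have notin: "v \<notin> set vs"
    using le by (auto simp: not_le[symmetric])
  have vs: "vs \<noteq> []" "last vs = u"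
    using path by (auto simp: simple_path_def walk_def)
  have "simple_path n m a 1 v (vs @ [v])"
    using path notin vs i predecessor.prems(1)
    by (auto simp: simple_path_def walk_def successively_append_iff adjacent_def)
  moreover have "\<forall>w\<in>set (vs @ [v]). dist \<sigma> w \<le> dist \<sigma> v"
    using le less by auto
  moreover have "path_weight m a (vs @ [v]) = path_weight m a vs + arc_weight i"
    using path_weight_snoc[OF inj vs(1) notin i(1)] i(2) vs(2) by simp
  then have "enat (path_weight m a (vs @ [v])) = dist \<sigma> v"
    by (simp add: eq flip: weight)
  ultimately show ?case by blast
qed

text \<open>The universal part covers every choice among nearest nodes and every relaxation order;
  the existential part prevents it from holding vacuously.\<close>

theorem theorem2:
  fixes n m :: nat and a :: "nat \<Rightarrow> nat set"
  assumes "connected_simple_graph n m a"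
  shows "(\<exists>P. earliest_path_output n m a P) \<and>
         (\<forall>P. earliest_path_output n m a P \<longrightarrow>
            simple_path n m a 1 n P \<and>
            \<not> (\<exists>X. simple_path n m a 1 n X \<and>
                   bat_less m (arc_vector m a X) (arc_vector m a P)))"
proof -
  have n: "1 \<le> n" "n \<in> {1..n}" and inj: "inj_on a {1..m}"
    and graph: "\<forall>i\<in>{1..m}. a i \<subseteq> {1..n} \<and> card (a i) = 2"
    using assms by (auto simp: connected_simple_graph_def)
  \<comment> \<open>Connectedness enters here: the walk \<open>W\<close> makes the distance of the
    sink finite in every run.\<close>
  obtain W where W: "walk n m a 1 n W"
    using assms n unfolding connected_simple_graph_def by (meson atLeastAtMost_iff order_refl)
  \<comment> \<open>The final marking leaves \<open>prev\<close> untouched, so the traceback may be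
    analysed in \<open>\<rho>\<close>, where the sink is still unprocessed.\<close>
  have final: "\<exists>\<rho>. loop_invariant n m a \<rho> \<and> nearest_unprocessed \<rho> n \<and>
      prev_consistent n m a \<rho> \<and> dist \<rho> n < \<infinity> \<and> prev \<sigma> = prev \<rho>"
    if run: "dijkstra n m a (dijkstra_init n) \<sigma>" for \<sigma>
  proof -
    obtain \<rho> where \<rho>: "loop_invariant n m a \<rho>" "nearest_unprocessed \<rho> n"
      "\<sigma> = mark_processed n \<rho>"
      using dijkstra_final_state[OF graph run loop_invariant_init[OF n(1)]] .
    have "dist \<rho> n < \<infinity>"
      using cut_off_dist_finite[OF \<rho>(1,2) W] by simp
    with \<rho> show ?thesis
      by (auto simp: loop_invariant_def mark_processed_def)
  qed
  have "\<exists>P. earliest_path_output n m a P"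
    using dijkstra_terminates[OF graph loop_invariant_init[OF n(1)]] final traceback_exists
    unfolding earliest_path_output_def by metis
  moreover have "simple_path n m a 1 n P \<and>
      \<not> (\<exists>X. simple_path n m a 1 n X \<and> bat_less m (arc_vector m a X) (arc_vector m a P))"
    if "earliest_path_output n m a P" for P
  proof -
    obtain \<rho> where inv: "loop_invariant n m a \<rho>" and near: "nearest_unprocessed \<rho> n"
      and cons: "prev_consistent n m a \<rho>" and fin: "dist \<rho> n < \<infinity>"
      and tr: "traceback (prev \<rho>) 1 n P"
      using \<open>earliest_path_output n m a P\<close> final unfolding earliest_path_output_def by metis
    have P: "simple_path n m a 1 n P" "enat (path_weight m a P) = dist \<rho> n"
      using traceback_simple_path[OF inj cons tr n(2) fin] by auto
    \<comment> \<open>At the sink the minimum collapses to \<open>dist \<rho> n\<close>, which is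
      the weight of \<open>P\<close>.\<close>
    have "\<not> path_weight m a X < path_weight m a P" if "simple_path n m a 1 n X" for X
      using cut_off_dist_le_path_weight[OF inj inv near that] by (simp flip: P(2))
    with P(1) show ?thesis
      using bat_less_imp_path_weight_less by blast
  qed
  ultimately show ?thesis by blast
qed

end
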